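(* For all integers $2\leq k\leq n$, there exists an $n$-chain group $G_k$ such that $H_1(G_k,\mathbb{Z})\cong\mathbb{Z}^k$.
   Context: $\mathrm{Homeo}^+(\mathbb{R})$ is the group of orientation preserving homeomorphisms of $\mathbb{R}$; $\operatorname{supp} f=\{x: f(x)\ne x\}$. For an interval $J$, $\partial^-J$ is its left endpoint. $H_1(G,\mathbb{Z})$ is the abelianization of $G$. Chain of intervals: a collection $\{J_1,\ldots,J_n\}$ of nonempty open subintervals of $\mathbb{R}$ (possibly unbounded) such that $J_i\cap J_k=\varnothing$ if $|i-k|>1$, and $J_i\cap J_{i+1}$ is a proper nonempty subinterval of both $J_i$ and $J_{i+1}$ for $1\le i\le n-1$. $n$-chain group ($n\ge 2$): a group $\langle f_1,\ldots,f_n\rangle\le\mathrm{Homeo}^+(\mathbb{R})$ where $\{\operatorname{supp} f_1,\dots,\operatorname{supp} f_n\}$ is a chain of intervals with $\partial^-\operatorname{supp} f_i<\partial^-\operatorname{supp} f_{i+1}$ for all $i<n$, $f_i(t)\ge t$ for all $t$ and $i$, and $\langle f_i,f_{i+1}\rangle\cong F$ for each $1\le i\le n-1$. Here $F=\langle \{g_i\}_{i\ge0}\mid g_i^{-1}g_jg_i=g_{j+1}\text{ for }0\le i<j\rangle$ is Thompson's group. *)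

theory Defs
  imports
    "HOL-Analysis.Analysis"
    "HOL-Algebra.Generated_Groups"
    "HOL-Algebra.Elementary_Groups"
    "HOL-Algebra.Product_Groups"
begin

definition homeo_plus :: "(real \<Rightarrow> real) monoid" where
  "homeo_plus =
     \<lparr>carrier = {f. (\<exists>g. homeomorphism UNIV UNIV f g) \<and> strict_mono f},
      mult = (\<circ>), one = id\<rparr>"

text \<open>The support is the set of moved points itself, not its closure.\<close>

definition supp :: "(real \<Rightarrow> real) \<Rightarrow> real set" where
  "supp f = {x. f x \<noteq> x}"

text \<open>Intervals may be unbounded, so endpoints are extended reals.\<close>

definition left_endpoint :: "real set \<Rightarrow> ereal" where
  "left_endpoint J = Inf (ereal ` J)"

definition chain_of_intervals :: "nat \<Rightarrow> (nat \<Rightarrow> real set) \<Rightarrow> bool" where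
  "chain_of_intervals n J \<longleftrightarrow>
     (\<forall>i\<in>{1..n}. J i \<noteq> {} \<and> open (J i) \<and> is_interval (J i)) \<and>
     (\<forall>i\<in>{1..n}. \<forall>k\<in>{1..n}. \<bar>int i - int k\<bar> > 1 \<longrightarrow> J i \<inter> J k = {}) \<and>
     (\<forall>i\<in>{1..<n}. J i \<inter> J (i + 1) \<noteq> {} \<and> is_interval (J i \<inter> J (i + 1)) \<and>
        J i \<inter> J (i + 1) \<subset> J i \<and> J i \<inter> J (i + 1) \<subset> J (i + 1))"

text \<open>
  Groups given by a presentation. A word is a list of letters \<open>(x, b)\<close>, where \<open>(x, True)\<close> is the
  generator \<open>x\<close> and \<open>(x, False)\<close> is its formal inverse; a pair \<open>(l, r)\<close> in \<open>R\<close> is the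
  relation \<open>l = r\<close>. All elements of the type \<open>'a\<close> are generators.
\<close>

type_synonym 'a word = "('a \<times> bool) list"

inductive word_eq :: "('a word \<times> 'a word) set \<Rightarrow> 'a word \<Rightarrow> 'a word \<Rightarrow> bool"
  for R :: "('a word \<times> 'a word) set" where
  word_refl: "word_eq R u u"
| word_sym: "word_eq R u v \<Longrightarrow> word_eq R v u"
| word_trans: "word_eq R u v \<Longrightarrow> word_eq R v w \<Longrightarrow> word_eq R u w"
| word_cancel: "word_eq R (u @ [(x, b), (x, \<not> b)] @ v) (u @ v)"
| word_relation: "(l, r) \<in> R \<Longrightarrow> word_eq R (u @ l @ v) (u @ r @ v)"

definition word_class :: "('a word \<times> 'a word) set \<Rightarrow> 'a word \<Rightarrow> 'a word set" where
  "word_class R u = {v. word_eq R u v}"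

definition presented_group :: "('a word \<times> 'a word) set \<Rightarrow> 'a word set monoid" where
  "presented_group R =
     \<lparr>carrier = range (word_class R),
      mult = (\<lambda>A B. \<Union>a\<in>A. \<Union>b\<in>B. word_class R (a @ b)),
      one = word_class R []\<rparr>"

definition thompson_F :: "nat word set monoid" where
  "thompson_F = presented_group
     {([(i, False), (j, True), (i, True)], [(j + 1, True)]) | i j. i < j}"

definition chain_group :: "nat \<Rightarrow> (real \<Rightarrow> real) monoid \<Rightarrow> bool" where
  "chain_group n G \<longleftrightarrow> n \<ge> 2 \<and>
     (\<exists>f. (\<forall>i\<in>{1..n}. f i \<in> carrier homeo_plus) \<and>
          G = subgroup_generated homeo_plus (f ` {1..n}) \<and>
          chain_of_intervals n (\<lambda>i. supp (f i)) \<and>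
          (\<forall>i\<in>{1..<n}. left_endpoint (supp (f i)) < left_endpoint (supp (f (i + 1)))) \<and>
          (\<forall>i\<in>{1..n}. \<forall>t. f i t \<ge> t) \<and>
          (\<forall>i\<in>{1..<n}. subgroup_generated homeo_plus {f i, f (i + 1)} \<cong> thompson_F))"

definition abelianization :: "('a, 'b) monoid_scheme \<Rightarrow> 'a set monoid" where
  "abelianization G = G Mod (derived G (carrier G))"


subsection \<open>The objects above are groups\<close>

lemma group_homeo_plus: "group homeo_plus"
proof (rule groupI)
  fix f g assume "f \<in> carrier homeo_plus" "g \<in> carrier homeo_plus"
  then obtain f' g' where fg: "homeomorphism UNIV UNIV f f'" "strict_mono f"
      "homeomorphism UNIV UNIV g g'" "strict_mono g"
    by (auto simp: homeo_plus_def)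
  have "homeomorphism UNIV UNIV (f \<circ> g) (g' \<circ> f')"
    by (rule homeomorphism_compose[OF fg(3) fg(1)])
  moreover have "strict_mono (f \<circ> g)"
    using fg(2,4) by (simp add: strict_mono_def)
  ultimately show "f \<otimes>\<^bsub>homeo_plus\<^esub> g \<in> carrier homeo_plus"
    by (auto simp: homeo_plus_def)
next
  show "\<one>\<^bsub>homeo_plus\<^esub> \<in> carrier homeo_plus"
    using homeomorphism_ident[of "UNIV :: real set"]
    by (auto simp: homeo_plus_def id_def strict_mono_def)
next
  fix f assume "f \<in> carrier homeo_plus"
  then obtain g where g: "homeomorphism UNIV UNIV f g" and f: "strict_mono f"
    by (auto simp: homeo_plus_def)
  have inv: "f (g x) = x" "g (f x) = x" for x
    using g by (auto simp: homeomorphism_def)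
  have "strict_mono g"
    by (rule strict_monoI) (metis f inv(1) strict_mono_less)
  then have "g \<in> carrier homeo_plus"
    using homeomorphism_symD[OF g] by (auto simp: homeo_plus_def)
  moreover have "g \<otimes>\<^bsub>homeo_plus\<^esub> f = \<one>\<^bsub>homeo_plus\<^esub>"
    using inv by (auto simp: homeo_plus_def)
  ultimately show "\<exists>h\<in>carrier homeo_plus. h \<otimes>\<^bsub>homeo_plus\<^esub> f = \<one>\<^bsub>homeo_plus\<^esub>"
    by blast
qed (simp_all add: homeo_plus_def comp_assoc)

lemma word_class_eq_iff: "word_class R u = word_class R v \<longleftrightarrow> word_eq R u v"
proof
  assume "word_class R u = word_class R v"
  moreover have "v \<in> word_class R v"
    by (simp add: word_class_def word_refl)
  ultimately show "word_eq R u v"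
    by (simp add: word_class_def set_eq_iff)
next
  assume uv: "word_eq R u v"
  have "word_eq R u w \<longleftrightarrow> word_eq R v w" for w
    using word_trans[OF uv] word_trans[OF word_sym[OF uv]] by blast
  then show "word_class R u = word_class R v"
    by (simp add: word_class_def)
qed

lemma word_eq_context: "word_eq R u v \<Longrightarrow> word_eq R (p @ u @ q) (p @ v @ q)"
proof (induction rule: word_eq.induct)
  case (word_cancel u x b v)
  show ?case using word_eq.word_cancel[of R "p @ u" x b "v @ q"] by simp
next
  case (word_relation l r u v)
  then show ?case using word_eq.word_relation[of l r R "p @ u" "v @ q"] by simp
next
  case (word_trans u v w)
  then show ?case using word_eq.word_trans by blast
qed (simp_all add: word_refl word_sym)

lemma word_eq_append:
  assumes "word_eq R u u'" "word_eq R v v'"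
  shows "word_eq R (u @ v) (u' @ v')"
proof (rule word_trans)
  show "word_eq R (u @ v) (u' @ v)"
    using word_eq_context[OF assms(1), of "[]" v] by simp
  show "word_eq R (u' @ v) (u' @ v')"
    using word_eq_context[OF assms(2), of u' "[]"] by simp
qed

lemma mult_presented_group:
  "word_class R u \<otimes>\<^bsub>presented_group R\<^esub> word_class R v = word_class R (u @ v)"
proof -
  have eq: "word_class R (a @ b) = word_class R (u @ v)"
    if "a \<in> word_class R u" "b \<in> word_class R v" for a b
    using that word_eq_append[of R u a v b] word_class_eq_iff[of R "u @ v" "a @ b"]
    by (auto simp: word_class_def)
  have ne: "word_class R u \<noteq> {}" "word_class R v \<noteq> {}"
    using word_refl by (auto simp: word_class_def)
  have "(\<Union>a\<in>word_class R u. \<Union>b\<in>word_class R v. word_class R (a @ b)) =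
        (\<Union>a\<in>word_class R u. \<Union>b\<in>word_class R v. word_class R (u @ v))"
    by (intro SUP_cong HOL.refl eq)
  then show ?thesis
    using ne by (simp add: presented_group_def)
qed

lemma word_inverse: "word_eq R (rev (map (\<lambda>(x, b). (x, \<not> b)) u) @ u) []"
proof (induction u)
  case (Cons a u)
  obtain x b where a: "a = (x, b)" by (cases a)
  let ?w = "rev (map (\<lambda>(x, b). (x, \<not> b)) u)"
  have "word_eq R (?w @ [(x, \<not> b), (x, \<not> \<not> b)] @ u) []"
    by (rule word_trans[OF word_cancel Cons])
  then show ?case by (simp add: a)
qed (simp add: word_refl)

lemma group_presented_group: "group (presented_group R)"
proof (rule groupI)
  fix A assume "A \<in> carrier (presented_group R)"
  then obtain u where u: "A = word_class R u"
    by (auto simp: presented_group_def)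
  define v where "v = rev (map (\<lambda>(x, b). (x, \<not> b)) u)"
  have "word_class R v \<otimes>\<^bsub>presented_group R\<^esub> A = word_class R []"
    using word_inverse[of R u] by (simp add: u v_def mult_presented_group word_class_eq_iff)
  then show "\<exists>B\<in>carrier (presented_group R). B \<otimes>\<^bsub>presented_group R\<^esub> A = \<one>\<^bsub>presented_group R\<^esub>"
    by (intro bexI[of _ "word_class R v"]) (auto simp: presented_group_def)
  show "\<one>\<^bsub>presented_group R\<^esub> \<otimes>\<^bsub>presented_group R\<^esub> A = A"
    using mult_presented_group[of R "[]" u] by (simp add: u presented_group_def)
next
  fix A B assume "A \<in> carrier (presented_group R)" "B \<in> carrier (presented_group R)"
  then obtain u v where uv: "A = word_class R u" "B = word_class R v"
    by (auto simp: presented_group_def)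
  show "A \<otimes>\<^bsub>presented_group R\<^esub> B \<in> carrier (presented_group R)"
    unfolding uv mult_presented_group by (simp add: presented_group_def)
  fix C assume "C \<in> carrier (presented_group R)"
  then obtain w where w: "C = word_class R w"
    by (auto simp: presented_group_def)
  show "A \<otimes>\<^bsub>presented_group R\<^esub> B \<otimes>\<^bsub>presented_group R\<^esub> C =
        A \<otimes>\<^bsub>presented_group R\<^esub> (B \<otimes>\<^bsub>presented_group R\<^esub> C)"
    unfolding uv w mult_presented_group by simp
qed (simp add: presented_group_def)

lemma comm_group_abelianization:
  assumes "group G"
  shows "comm_group (abelianization G)"
  unfolding abelianization_def
  by (simp add: assms group.derived_quot_is_group group.derived_quot_is_comm_group)

end

theory Submission
  imports Defs "HOL-Algebra.FiniteProduct"
begin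

text \<open>
  Let \<open>p = k - 1\<close> and let \<open>y\<^sub>j\<close> be the map that is the identity left of \<open>j\<close>, has slope
  \<open>k\<close> on \<open>[j, j + 1]\<close> and is the translation by \<open>p\<close> right of \<open>j + 1\<close>. These maps satisfy
  \<open>y\<^sub>i y\<^sub>j = y\<^sub>j\<^sub>+\<^sub>p y\<^sub>i\<close> for \<open>i < j\<close>, and they generate a copy of the Brown--Thompson group
  \<open>\<langle>g\<^sub>0, g\<^sub>1, \<dots> | g\<^sub>i\<inverse> g\<^sub>j g\<^sub>i = g\<^sub>j\<^sub>+\<^sub>p (i < j)\<rangle>\<close>, whose abelianization is free on the classes of
  \<open>g\<^sub>0, \<dots>, g\<^sub>p\<close>. The chain consists of \<open>f\<^sub>i = y\<^sub>(\<^sub>i\<^sub>-\<^sub>1\<^sub>)\<^sub>k y\<^sub>i\<^sub>k\<inverse>\<close> for \<open>i < n\<close>, with support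
  \<open>((i - 1)k, (i + 1)k)\<close>, and \<open>f\<^sub>n = y\<^sub>(\<^sub>n\<^sub>-\<^sub>1\<^sub>)\<^sub>k\<close>. As \<open>k\<close> is \<open>1\<close> modulo \<open>p\<close> and
  \<open>n > p\<close>, the indices \<open>k, 2k, \<dots>, (n - 1)k\<close> meet every residue class modulo \<open>p\<close>, so
  conjugation by \<open>y\<^sub>0\<close> recovers all the \<open>y\<^sub>j\<close> from the chain.
\<close>

section \<open>Groups given by a presentation\<close>

definition word_val :: "('b, 'c) monoid_scheme \<Rightarrow> ('a \<Rightarrow> 'b) \<Rightarrow> 'a word \<Rightarrow> 'b" where
  "word_val H e w =
     foldr (\<lambda>(x, b) y. (if b then e x else inv\<^bsub>H\<^esub> e x) \<otimes>\<^bsub>H\<^esub> y) w \<one>\<^bsub>H\<^esub>"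

lemma word_val_Nil [simp]: "word_val H e [] = \<one>\<^bsub>H\<^esub>"
  by (simp add: word_val_def)

lemma word_val_Cons [simp]:
  "word_val H e ((x, b) # w) = (if b then e x else inv\<^bsub>H\<^esub> e x) \<otimes>\<^bsub>H\<^esub> word_val H e w"
  by (simp add: word_val_def)

lemma (in group) word_val_closed [simp]:
  assumes "\<And>x. e x \<in> carrier G"
  shows "word_val G e w \<in> carrier G"
  using assms by (induction w) auto

lemma (in group) word_val_append:
  assumes "\<And>x. e x \<in> carrier G"
  shows "word_val G e (u @ v) = word_val G e u \<otimes> word_val G e v"
  using assms by (induction u) (auto simp: m_assoc)

lemma (in group) word_val_eq:
  assumes "word_eq R u v" and e: "\<And>x. e x \<in> carrier G"
    and R: "\<And>l r. (l, r) \<in> R \<Longrightarrow> word_val G e l = word_val G e r"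
  shows "word_val G e u = word_val G e v"
  using assms(1)
proof (induction rule: word_eq.induct)
  case (word_cancel u x b v)
  have "word_val G e ([(x, b), (x, \<not> b)] @ v) = word_val G e v"
    using e by (simp add: m_assoc[symmetric])
  then show ?case
    using e by (simp only: word_val_append)
qed (use e R in \<open>simp_all add: word_val_append\<close>)

text \<open>Von Dyck's theorem. Evaluation of words respects \<open>word_eq\<close>, because
  cancellation holds in every group and the relations hold in \<open>G\<close> by
  assumption.\<close>

lemma (in group) presented_group_hom:
  assumes e: "\<And>x. e x \<in> carrier G"
    and R: "\<And>l r. (l, r) \<in> R \<Longrightarrow> word_val G e l = word_val G e r"
  obtains h where "h \<in> hom (presented_group R) G"
    and "\<And>w. h (word_class R w) = word_val G e w"
proof
  \<comment> \<open>Any representative of the class may be chosen, since \<open>word_val_eq\<close>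
    gives all of them the same value.\<close>
  define h where "h = (\<lambda>A. word_val G e (SOME w. w \<in> A))"
  show h: "h (word_class R w) = word_val G e w" for w
  proof -
    have "w \<in> word_class R w"
      by (simp add: word_class_def word_refl)
    then have "(SOME u. u \<in> word_class R w) \<in> word_class R w"
      by (rule someI)
    then show ?thesis
      unfolding h_def using word_val_eq[OF _ e R] by (auto simp: word_class_def)
  qed
  show "h \<in> hom (presented_group R) G"
  proof (rule homI)
    fix A assume "A \<in> carrier (presented_group R)"
    then show "h A \<in> carrier G"
      using e h by (auto simp: presented_group_def)
  next
    fix A B assume "A \<in> carrier (presented_group R)" "B \<in> carrier (presented_group R)"
    then obtain u v where "A = word_class R u" "B = word_class R v"
      by (auto simp: presented_group_def)
    then show "h (A \<otimes>\<^bsub>presented_group R\<^esub> B) = h A \<otimes> h B"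
      using e by (simp add: mult_presented_group h word_val_append)
  qed
qed

lemma (in group_hom) hom_word_val:
  assumes e: "\<And>x. e x \<in> carrier G"
  shows "h (word_val G e w) = word_val H (h \<circ> e) w"
  using e by (induction w) auto

definition pgen :: "('a word \<times> 'a word) set \<Rightarrow> 'a \<Rightarrow> 'a word set" where
  "pgen R x = word_class R [(x, True)]"

lemma carrier_presented_group: "carrier (presented_group R) = range (word_class R)"
  by (simp add: presented_group_def)

lemma one_presented_group: "\<one>\<^bsub>presented_group R\<^esub> = word_class R []"
  by (simp add: presented_group_def)

lemma pgen_closed [simp]: "pgen R x \<in> carrier (presented_group R)"
  by (simp add: pgen_def carrier_presented_group)

lemma inv_pgen: "inv\<^bsub>presented_group R\<^esub> pgen R x = word_class R [(x, False)]"
proof (rule group.inv_equality[OF group_presented_group])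
  have "word_eq R [(x, False), (x, True)] []"
    using word_cancel[of R "[]" x False "[]"] by simp
  then show "word_class R [(x, False)] \<otimes>\<^bsub>presented_group R\<^esub> pgen R x = \<one>\<^bsub>presented_group R\<^esub>"
    by (simp add: pgen_def mult_presented_group word_class_eq_iff one_presented_group)
qed (auto simp: pgen_def carrier_presented_group)

text \<open>Evaluation in the presented group itself is the quotient map; hence every element is a
  product of generators and their inverses.\<close>

lemma word_val_pgen: "word_val (presented_group R) (pgen R) w = word_class R w"
proof (induction w)
  case Nil
  show ?case by (simp add: one_presented_group)
next
  case (Cons a w)
  obtain x b where "a = (x, b)" by (cases a)
  then show ?case
    using Cons mult_presented_group[of R "[(x, b)]" w]
    by (cases b) (simp_all add: inv_pgen, simp add: pgen_def)
qed

lemma carrier_presented_groupE: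
  assumes "A \<in> carrier (presented_group R)"
  obtains w where "A = word_val (presented_group R) (pgen R) w"
  using assms by (auto simp: word_val_pgen carrier_presented_group)


section \<open>Families satisfying the Brown--Thompson relations\<close>

definition brown_thompson_rel :: "nat \<Rightarrow> (nat word \<times> nat word) set" where
  "brown_thompson_rel p =
     {([(i, False), (j, True), (i, True)], [(j + p, True)]) | i j. i < j}"

abbreviation brown_thompson :: "nat \<Rightarrow> nat word set monoid" where
  "brown_thompson p \<equiv> presented_group (brown_thompson_rel p)"

lemma thompson_F_eq: "thompson_F = brown_thompson 1"
  by (simp add: thompson_F_def brown_thompson_rel_def)

text \<open>This lemma and the next are the two moves by which an inverse standing to the right of a
  letter passes to its left.\<close>

lemma (in group) swap_inv_right:
  assumes "a \<otimes> b = d \<otimes> a" "a \<in> carrier G" "b \<in> carrier G" "d \<in> carrier G"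
  shows "b \<otimes> inv a = inv a \<otimes> d"
proof -
  have "b \<otimes> inv a = inv a \<otimes> (a \<otimes> b) \<otimes> inv a"
    using assms(2-) by (simp add: m_assoc[symmetric])
  also have "\<dots> = inv a \<otimes> d"
    using assms by (simp add: m_assoc)
  finally show ?thesis .
qed

lemma (in group) swap_inv_left:
  assumes "a \<otimes> b = d \<otimes> a" "a \<in> carrier G" "b \<in> carrier G" "d \<in> carrier G"
  shows "a \<otimes> inv b = inv d \<otimes> a"
proof -
  have "inv d \<otimes> a = inv d \<otimes> (a \<otimes> b) \<otimes> inv b"
    using assms(2-) by (simp add: m_assoc)
  also have "\<dots> = a \<otimes> inv b"
    unfolding assms(1) using assms(2-) by (simp add: m_assoc[symmetric])
  finally show ?thesis ..
qed

text \<open>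
  The relations are written in the form satisfied by maps acting from the left, so the \<open>c i\<close>
  correspond to the inverses of the generators of the presented group.
\<close>

locale shift_family = group G for G (structure) +
  fixes c :: "nat \<Rightarrow> 'a" and p :: nat
  assumes c_closed [simp]: "c i \<in> carrier G"
    and shift: "i < j \<Longrightarrow> c i \<otimes> c j = c (j + p) \<otimes> c i"
begin

definition pos :: "nat list \<Rightarrow> 'a" where
  "pos w = foldr (\<lambda>i y. c i \<otimes> y) w \<one>"

lemma pos_Nil [simp]: "pos [] = \<one>"
  by (simp add: pos_def)

lemma pos_Cons [simp]: "pos (i # w) = c i \<otimes> pos w"
  by (simp add: pos_def)

lemma pos_closed [simp]: "pos w \<in> carrier G"
  by (induction w) auto

lemma pos_append [simp]: "pos (u @ v) = pos u \<otimes> pos v"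
  by (induction u) (auto simp: m_assoc)

lemma pos_shift:
  "\<forall>j\<in>set w. i < j \<Longrightarrow> c i \<otimes> pos w = pos (map (\<lambda>j. j + p) w) \<otimes> c i"
proof (induction w)
  case (Cons j w)
  have "c i \<otimes> (c j \<otimes> pos w) = c (j + p) \<otimes> c i \<otimes> pos w"
    using Cons.prems by (simp add: m_assoc[symmetric] shift)
  also have "\<dots> = c (j + p) \<otimes> (pos (map (\<lambda>j. j + p) w) \<otimes> c i)"
    using Cons by (simp add: m_assoc)
  finally show ?case by (simp add: m_assoc)
qed simp

text \<open>A new first letter \<open>i\<close> is compared with the least letter \<open>j\<close>
  already at the end. If \<open>i\<close> is smaller, it is pulled through to the end, which raises
  every other letter by \<open>p\<close> and so keeps them above \<open>i\<close>. The length is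
  recorded for a later induction on it.\<close>

lemma pos_extract_min:
  "w \<noteq> [] \<Longrightarrow> \<exists>j w'. pos w = pos w' \<otimes> c j \<and> (\<forall>l\<in>set w'. j \<le> l) \<and> length w = Suc (length w')"
proof (induction w)
  case (Cons i w)
  show ?case
  proof (cases "w = []")
    case True
    then show ?thesis by (intro exI[of _ i] exI[of _ "[]"]) simp
  next
    case False
    then obtain j w' where w: "pos w = pos w' \<otimes> c j" "\<forall>l\<in>set w'. j \<le> l" "length w = Suc (length w')"
      using Cons.IH by blast
    show ?thesis
    proof (cases "j \<le> i")
      case True
      then show ?thesis
        using w by (intro exI[of _ j] exI[of _ "i # w'"]) (simp add: m_assoc)
    next
      case False
      then have "pos (i # w) = pos (map (\<lambda>j. j + p) (w' @ [j])) \<otimes> c i"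
        using w pos_shift[of "w' @ [j]" i] by fastforce
      then show ?thesis
        using w False by (intro exI[of _ i] exI[of _ "map (\<lambda>j. j + p) (w' @ [j])"]) auto
    qed
  qed
qed simp

text \<open>The inverse moves left through \<open>v\<close>. Equal letters cancel, a larger letter
  of \<open>v\<close> is raised by \<open>p\<close>, and a smaller one raises the inverse letter
  instead; hence the induction has \<open>i\<close> arbitrary.\<close>

lemma pos_right_inv: "\<exists>u v'. pos v \<otimes> inv (c i) = inv (pos u) \<otimes> pos v'"
proof (induction v arbitrary: i rule: rev_induct)
  case Nil
  show ?case by (intro exI[of _ "[i]"] exI[of _ "[]"]) simp
next
  case (snoc j v)
  consider "i = j" | "i < j" | "j < i" by linarith
  then show ?case
  proof cases
    case 1
    then show ?thesis by (intro exI[of _ "[]"] exI[of _ v]) (simp add: m_assoc)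
  next
    case 2
    obtain u v' where uv: "pos v \<otimes> inv (c i) = inv (pos u) \<otimes> pos v'" using snoc by blast
    have "pos (v @ [j]) \<otimes> inv (c i) = pos v \<otimes> inv (c i) \<otimes> c (j + p)"
      using swap_inv_right[OF shift[OF 2]] by (simp add: m_assoc)
    then show ?thesis
      unfolding uv by (intro exI[of _ u] exI[of _ "v' @ [j + p]"]) (simp add: m_assoc)
  next
    case 3
    obtain u v' where uv: "pos v \<otimes> inv (c (i + p)) = inv (pos u) \<otimes> pos v'" using snoc by blast
    have "c j \<otimes> inv (c i) = inv (c (i + p)) \<otimes> c j"
      by (rule swap_inv_left[OF shift[OF 3]]) simp_all
    then have "pos (v @ [j]) \<otimes> inv (c i) = pos v \<otimes> inv (c (i + p)) \<otimes> c j"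
      by (simp add: m_assoc)
    then show ?thesis
      unfolding uv by (intro exI[of _ u] exI[of _ "v' @ [j]"]) (simp add: m_assoc)
  qed
qed

text \<open>Letters are appended on the right. A formal inverse evaluates to \<open>c i\<close> and
  extends the numerator; a generator evaluates to \<open>inv (c i)\<close> and is moved into the
  denominator by \<open>pos_right_inv\<close>.\<close>

lemma word_val_fraction: "\<exists>u v. word_val G (\<lambda>i. inv (c i)) w = inv (pos u) \<otimes> pos v"
proof (induction w rule: rev_induct)
  case Nil
  show ?case by (intro exI[of _ "[]"]) simp
next
  case (snoc a w)
  obtain i b where a: "a = (i, b)" by (cases a)
  obtain u v where uv: "word_val G (\<lambda>i. inv (c i)) w = inv (pos u) \<otimes> pos v"
    using snoc by blast
  show ?case
  proof (cases b)
    case True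
    obtain u' v' where "pos v \<otimes> inv (c i) = inv (pos u') \<otimes> pos v'"
      using pos_right_inv by blast
    then have "word_val G (\<lambda>i. inv (c i)) (w @ [a]) = inv (pos (u' @ u)) \<otimes> pos v'"
      using True by (simp add: a word_val_append uv m_assoc inv_mult_group)
    then show ?thesis by blast
  next
    case False
    then have "word_val G (\<lambda>i. inv (c i)) (w @ [a]) = inv (pos u) \<otimes> pos (v @ [i])"
      by (simp add: a word_val_append uv m_assoc)
    then show ?thesis by blast
  qed
qed

end

text \<open>Inverting both sides of the defining relation gives exactly the shift relation for the
  inverse generators.\<close>

lemma shift_family_brown_thompson:
  "shift_family (brown_thompson p)
     (\<lambda>i. inv\<^bsub>brown_thompson p\<^esub> pgen (brown_thompson_rel p) i) p"
proof -
  define x where "x = pgen (brown_thompson_rel p)"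
  interpret group "brown_thompson p" by (rule group_presented_group)
  have x [simp]: "x i \<in> carrier (brown_thompson p)" for i
    by (simp add: x_def)
  show ?thesis
  proof (unfold_locales; fold x_def)
    fix i j :: nat
    assume "i < j"
    then have "word_eq (brown_thompson_rel p) [(i, False), (j, True), (i, True)] [(j + p, True)]"
      using word_relation[of "[(i, False), (j, True), (i, True)]" "[(j + p, True)]" "brown_thompson_rel p" "[]" "[]"]
      by (auto simp: brown_thompson_rel_def)
    then have "inv\<^bsub>brown_thompson p\<^esub> x i \<otimes>\<^bsub>brown_thompson p\<^esub> (x j \<otimes>\<^bsub>brown_thompson p\<^esub> x i) = x (j + p)"
      using word_val_pgen[of "brown_thompson_rel p" "[(i, False), (j, True), (i, True)]"]
      by (simp add: word_class_eq_iff[symmetric] x_def[symmetric])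
        (simp add: x_def pgen_def)
    then have "inv\<^bsub>brown_thompson p\<^esub> x (j + p) =
        inv\<^bsub>brown_thompson p\<^esub> (inv\<^bsub>brown_thompson p\<^esub> x i \<otimes>\<^bsub>brown_thompson p\<^esub> (x j \<otimes>\<^bsub>brown_thompson p\<^esub> x i))"
      by simp
    then show "inv\<^bsub>brown_thompson p\<^esub> x i \<otimes>\<^bsub>brown_thompson p\<^esub> inv\<^bsub>brown_thompson p\<^esub> x j =
        inv\<^bsub>brown_thompson p\<^esub> x (j + p) \<otimes>\<^bsub>brown_thompson p\<^esub> inv\<^bsub>brown_thompson p\<^esub> x i"
      by (simp add: inv_mult_group m_assoc)
  qed simp
qed


section \<open>Faithful actions on the line\<close>

lemma homeo_plus_mult [simp]: "f \<otimes>\<^bsub>homeo_plus\<^esub> g = f \<circ> g"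
  by (simp add: homeo_plus_def)

lemma homeo_plus_one [simp]: "\<one>\<^bsub>homeo_plus\<^esub> = id"
  by (simp add: homeo_plus_def)

lemma homeo_plusD:
  assumes "f \<in> carrier homeo_plus"
  shows "strict_mono f" "surj f"
  using assms by (auto simp: homeo_plus_def homeomorphism_def)

lemma homeo_plus_inv [simp]:
  assumes "f \<in> carrier homeo_plus"
  shows "(inv\<^bsub>homeo_plus\<^esub> f) (f t) = t" "f ((inv\<^bsub>homeo_plus\<^esub> f) t) = t"
  using group.l_inv[OF group_homeo_plus assms] group.r_inv[OF group_homeo_plus assms]
  by (simp_all add: fun_eq_iff)

lemma (in group) subgroup_generated_eqI:
  assumes "S \<subseteq> carrier G" "T \<subseteq> carrier G" "S \<subseteq> generate G T" "T \<subseteq> generate G S"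
  shows "subgroup_generated G S = subgroup_generated G T"
proof -
  have "generate G S = generate G T"
    using assms generate_subgroup_incl generate_is_subgroup by (intro equalityI) blast+
  then show ?thesis
    using assms by (simp add: subgroup_generated_def Int_absorb1)
qed

text \<open>
  Every element is a fraction \<open>u\<inverse>v\<close> of positive words, and a positive word can be rewritten to
  end in its least letter. The points \<open>d l\<close> detect that letter, so positive words with
  the same action are equal in the presented group.
\<close>

lemma brown_thompson_iso:
  fixes z :: "nat \<Rightarrow> real \<Rightarrow> real" and d :: "nat \<Rightarrow> real"
  assumes z [simp]: "\<And>i. z i \<in> carrier homeo_plus"
    and shift: "\<And>i j. i < j \<Longrightarrow> z i \<circ> z j = z (j + p) \<circ> z i"
    and le: "\<And>i t. t \<le> z i t"
    and moved: "\<And>j l. j < l \<Longrightarrow> d l < z j (d l)"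
    and stays: "\<And>j l. l \<le> j \<Longrightarrow> z j (d l) = d l"
  shows "brown_thompson p \<cong> subgroup_generated homeo_plus (range z)"
proof -
  define P where "P = brown_thompson p"
  define x where "x = pgen (brown_thompson_rel p)"
  interpret H: group homeo_plus by (rule group_homeo_plus)
  interpret Z: shift_family homeo_plus z p
    by unfold_locales (simp_all add: shift)
  interpret B: shift_family P "\<lambda>i. inv\<^bsub>P\<^esub> x i" p
    unfolding P_def x_def by (rule shift_family_brown_thompson)
  have x [simp]: "x i \<in> carrier P" for i
    by (simp add: P_def x_def)
  \<comment> \<open>Generators go to inverses, so that \<open>h\<close> sends the positive words
    \<open>B.pos w\<close> to \<open>Z.pos w\<close>.\<close>
  define e where "e = (\<lambda>i. inv\<^bsub>homeo_plus\<^esub> z i)"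
  have e [simp]: "e i \<in> carrier homeo_plus" for i
    by (simp add: e_def)
  have "word_val homeo_plus e l = word_val homeo_plus e r" if lr: "(l, r) \<in> brown_thompson_rel p" for l r
  proof -
    obtain i j where ij: "l = [(i, False), (j, True), (i, True)]" "r = [(j + p, True)]" "i < j"
      using lr by (auto simp: brown_thompson_rel_def)
    have "z i \<otimes>\<^bsub>homeo_plus\<^esub> e j = e (j + p) \<otimes>\<^bsub>homeo_plus\<^esub> z i"
      unfolding e_def by (rule H.swap_inv_left[OF Z.shift[OF ij(3)]]) simp_all
    then show ?thesis
      by (simp add: ij fun_eq_iff e_def)
  qed
  then obtain h where "h \<in> hom (brown_thompson p) homeo_plus"
    and hw: "\<And>w. h (word_class (brown_thompson_rel p) w) = word_val homeo_plus e w"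
    using H.presented_group_hom[of e "brown_thompson_rel p"] e by metis
  then interpret h: group_hom P homeo_plus h
    by unfold_locales (simp add: P_def)
  have hx: "h (x i) = inv\<^bsub>homeo_plus\<^esub> z i" for i
    unfolding x_def pgen_def hw by (simp add: e_def)
  have h_pos: "h (B.pos w) = Z.pos w" for w
    by (induction w) (simp_all add: hx)
  have pos_le: "t \<le> Z.pos w t" for w t
    by (induction w) (auto intro: order_trans[OF _ le])
  have pos_stays: "Z.pos w (d l) = d l" if "\<forall>j\<in>set w. l \<le> j" for w l
    using that by (induction w) (simp_all add: stays)
  \<comment> \<open>No letter moves a point to the left, so a displacement caused by the first map
    applied is never undone.\<close>
  have pos_moved: "d l < (Z.pos w \<circ> z j) (d l)" if "j < l" for w j l
    using moved[OF that] pos_le[of "z j (d l)" w] by simp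
  have split_min: "\<exists>j w'. B.pos w = B.pos w' \<otimes>\<^bsub>P\<^esub> inv\<^bsub>P\<^esub> x j \<and> Z.pos w = Z.pos w' \<circ> z j \<and>
      (\<forall>l\<in>set w'. j \<le> l) \<and> length w = Suc (length w')" if "w \<noteq> []" for w
  proof -
    obtain j w' where *: "B.pos w = B.pos w' \<otimes>\<^bsub>P\<^esub> inv\<^bsub>P\<^esub> x j" "\<forall>l\<in>set w'. j \<le> l"
        "length w = Suc (length w')"
      using B.pos_extract_min[OF \<open>w \<noteq> []\<close>] by blast
    have "Z.pos w = Z.pos w' \<circ> z j"
      using arg_cong[OF *(1), of h] by (simp add: h_pos hx)
    then show ?thesis using * by blast
  qed
  \<comment> \<open>A word ending in its least letter \<open>j\<close> moves
    \<open>d (Suc j)\<close>.\<close>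
  have nontriv: "Z.pos w \<noteq> id" if "w \<noteq> []" for w
    using split_min[OF that] pos_moved[OF lessI] by (metis eq_id_iff less_irrefl)
  \<comment> \<open>Induction on length: the least letters brought to the end agree, and cancelling
    them leaves shorter words with equal action.\<close>
  have pos_inj: "B.pos u = B.pos v" if "Z.pos u = Z.pos v" for u v
    using that
  proof (induction "length u" arbitrary: u v)
    case 0
    then have "Z.pos v = id" using Z.pos_Nil homeo_plus_one by (metis length_0_conv)
    then have "v = []" using nontriv by blast
    then show ?case using 0 by simp
  next
    case (Suc m)
    have "u \<noteq> []" using Suc.hyps(2) by auto
    moreover have "v \<noteq> []" using nontriv[OF \<open>u \<noteq> []\<close>] Suc.prems by auto
    ultimately obtain j u' l v' where
      u: "B.pos u = B.pos u' \<otimes>\<^bsub>P\<^esub> inv\<^bsub>P\<^esub> x j" "Z.pos u = Z.pos u' \<circ> z j"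
        "\<forall>i\<in>set u'. j \<le> i" "length u = Suc (length u')" and
      v: "B.pos v = B.pos v' \<otimes>\<^bsub>P\<^esub> inv\<^bsub>P\<^esub> x l" "Z.pos v = Z.pos v' \<circ> z l"
        "\<forall>i\<in>set v'. l \<le> i"
      using split_min[of u] split_min[of v] by blast
    have eq: "Z.pos u' (z j t) = Z.pos v' (z l t)" for t
      using u(2) v(2) Suc.prems by (metis comp_apply)
    \<comment> \<open>If \<open>j < l\<close>, the first word moves \<open>d l\<close>, while the
      second has only letters \<open>>= l\<close> and fixes it.\<close>
    have "\<not> j < l"
      using pos_moved[of j l u'] pos_stays[of v' l] stays[of l l] v(3) eq[of "d l"] by auto
    moreover have "\<not> l < j"
      using pos_moved[of l j v'] pos_stays[of u' j] stays[of j j] u(3) eq[of "d j"] by auto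
    ultimately have "j = l" by simp
    have "Z.pos u' t = Z.pos v' t" for t
    proof -
      obtain t' where "t = z j t'" using homeo_plusD(2)[OF z, of j] by auto
      then show ?thesis using eq[of t'] \<open>j = l\<close> by simp
    qed
    then have "Z.pos u' = Z.pos v'" by blast
    then have "B.pos u' = B.pos v'"
      using Suc.hyps u(4) by simp
    then show ?case
      by (simp add: u v \<open>j = l\<close>)
  qed
  have "A = \<one>\<^bsub>P\<^esub>" if A: "A \<in> carrier P" "h A = id" for A
  proof -
    obtain w where "A = word_val P x w"
      using A(1) carrier_presented_groupE unfolding P_def x_def by blast
    \<comment> \<open>Double inverses bring the word into the form required by
      \<open>word_val_fraction\<close> for the family of the inverses
      \<open>inv (x i)\<close>.\<close>
    then have "A = word_val P (\<lambda>i. inv\<^bsub>P\<^esub> (inv\<^bsub>P\<^esub> x i)) w"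
      by simp
    then obtain u v where uv: "A = inv\<^bsub>P\<^esub> B.pos u \<otimes>\<^bsub>P\<^esub> B.pos v"
      using B.word_val_fraction by blast
    then have "inv\<^bsub>homeo_plus\<^esub> Z.pos u \<circ> Z.pos v = id"
      using A(2) by (simp add: h_pos)
    then have "(inv\<^bsub>homeo_plus\<^esub> Z.pos u) (Z.pos v t) = t" for t
      by (metis comp_apply id_apply)
    then have "Z.pos u t = Z.pos v t" for t
      using homeo_plus_inv(2)[OF Z.pos_closed] by metis
    then have "Z.pos u = Z.pos v" by blast
    then have "B.pos u = B.pos v" by (rule pos_inj)
    then show ?thesis by (simp add: uv)
  qed
  then have inj: "inj_on h (carrier P)"
    by (intro h.trivial_ker_imp_inj) (auto simp: kernel_def)
  have "h ` carrier P = generate homeo_plus (range z)"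
  proof
    have "word_val homeo_plus e w \<in> generate homeo_plus (range z)" for w
    proof (induction w)
      case (Cons a w)
      obtain i b where "a = (i, b)" by (cases a)
      have "z i \<in> generate homeo_plus (range z)" "e i \<in> generate homeo_plus (range z)"
        by (auto simp: e_def intro: generate.incl generate.inv)
      then have "(if b then e i else inv\<^bsub>homeo_plus\<^esub> e i) \<in> generate homeo_plus (range z)"
        by (simp add: e_def)
      then show ?case
        unfolding \<open>a = (i, b)\<close> word_val_Cons by (rule generate.eng[OF _ Cons])
    qed (simp only: word_val_Nil generate.one)
    then show "h ` carrier P \<subseteq> generate homeo_plus (range z)"
      by (auto simp: P_def carrier_presented_group hw)
    have "range z \<subseteq> h ` carrier P"
    proof (intro subsetI, elim rangeE, simp only:)
      fix i show "z i \<in> h ` carrier P"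
        using hx[of i] by (intro image_eqI[of _ _ "inv\<^bsub>P\<^esub> x i"]) simp_all
    qed
    then show "generate homeo_plus (range z) \<subseteq> h ` carrier P"
      by (rule H.generate_subgroup_incl[OF _ h.img_is_subgroup])
  qed
  moreover have "carrier (subgroup_generated homeo_plus (range z)) = generate homeo_plus (range z)"
    by (simp add: carrier_subgroup_generated Int_absorb1 image_subset_iff)
  ultimately have "h \<in> iso P (subgroup_generated homeo_plus (range z))"
    using inj by (auto simp: iso_def hom_def bij_betw_def)
  then show ?thesis
    by (auto simp: P_def is_iso_def)
qed


section \<open>Two maps with overlapping supports that generate Thompson's group\<close>

lemma funpow_le_funpow_iff:
  fixes s :: "real \<Rightarrow> real"
  assumes "strict_mono s"
  shows "(s ^^ m) x \<le> (s ^^ m) y \<longleftrightarrow> x \<le> y"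
  using assms by (induction m) (auto simp: strict_mono_less_eq)

text \<open>
  With \<open>s = g \<circ> f\<close>, the maps \<open>s, g, s g s\<inverse>, s\<^sup>2 g s\<^sup>-\<^sup>2, \<dots>\<close>
  satisfy the relations because \<open>f\<close> has its support to the left of that of \<open>s g s\<inverse>\<close>.
\<close>

lemma two_chain_thompson_F:
  fixes f g :: "real \<Rightarrow> real" and a b b' :: real
  assumes f: "f \<in> carrier homeo_plus" and g: "g \<in> carrier homeo_plus"
    and f_le: "\<And>t. t \<le> f t" and g_le: "\<And>t. t \<le> g t"
    and fa: "f a = a" and ab: "a < b"
    and f_id: "\<And>t. b' \<le> t \<Longrightarrow> f t = t" and g_id: "\<And>t. t \<le> b \<Longrightarrow> g t = t"
    and fb: "b < f b" and gf: "b' \<le> g (f b)"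
    and g_moves: "\<And>t. b < t \<Longrightarrow> t \<le> b' \<Longrightarrow> t < g t"
  shows "subgroup_generated homeo_plus {f, g} \<cong> thompson_F"
proof -
  interpret H: group homeo_plus by (rule group_homeo_plus)
  define s where "s = g \<circ> f"
  define w where "w = rec_nat g (\<lambda>_ u. s \<circ> u \<circ> inv\<^bsub>homeo_plus\<^esub> s)"
  define z where "z = case_nat s w"
  \<comment> \<open>Test points for \<open>brown_thompson_iso\<close>: \<open>a\<close> is fixed by
    all \<open>z j\<close>, and \<open>(s ^^ l) b\<close> is a point up to which \<open>w l\<close>
    is the identity.\<close>
  define d where "d = case_nat a (\<lambda>l. (s ^^ l) b)"
  have s [simp]: "s \<in> carrier homeo_plus"
    using H.m_closed[OF g f] by (simp add: s_def)
  have w0: "w 0 = g" and wS: "w (Suc m) = s \<circ> w m \<circ> inv\<^bsub>homeo_plus\<^esub> s" for m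
    by (simp_all add: w_def)
  have w [simp]: "w m \<in> carrier homeo_plus" for m
  proof (induction m)
    case (Suc m)
    then show ?case
      using H.m_closed[OF H.m_closed[OF s Suc] H.inv_closed[OF s]]
      unfolding wS homeo_plus_mult by blast
  qed (simp add: w0 g)
  have mono: "strict_mono f" "strict_mono g" "strict_mono s" and surj_s: "surj s"
    using f g homeo_plusD s by blast+
  have s_le: "t \<le> s t" for t
    using f_le[of t] g_le[of "f t"] by (simp add: s_def)
  have sw: "w (Suc m) (s t) = s (w m t)" for m t
    by (simp add: wS)
  have w_le: "t \<le> w m t" for m t
  proof (induction m arbitrary: t)
    case (Suc m)
    obtain u where "t = s u" using surj_s by auto
    then show ?case using Suc[of u] mono by (simp add: sw strict_mono_less_eq)
  qed (simp add: w0 g_le)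
  have w_id: "w m t = t" if "t \<le> (s ^^ m) b" for m t
    using that
  proof (induction m arbitrary: t)
    case (Suc m)
    obtain u where "t = s u" using surj_s by auto
    then show ?case using Suc mono by (simp add: sw strict_mono_less_eq)
  qed (simp add: w0 g_id)
  \<comment> \<open>\<open>f\<close> cannot carry a point across \<open>b'\<close>: up to
    \<open>b'\<close> the image stays where \<open>g_moves\<close> applies, and beyond
    \<open>b'\<close> the map \<open>f\<close> is the identity.\<close>
  have f_moved: "b < f t \<and> f t < g (f t)" if "b < t" "t < g t" for t
  proof (cases "t \<le> b'")
    case True
    have "f t \<le> f b'" using True mono by (simp add: strict_mono_less_eq)
    then have "f t \<le> b'" by (simp add: f_id)
    moreover have "b < f t" using f_le[of t] that by simp
    ultimately show ?thesis using g_moves by simp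
  qed (use that f_id in simp)
  have s_moved: "b < s t \<and> s t < g (s t)" if "b < f t \<and> f t < g (f t)" for t
    using that mono by (auto simp: s_def strict_mono_less)
  have "b \<le> b'"
    using fb f_id[of b] by force
  then have "f b \<le> f b'"
    using mono by (simp add: strict_mono_less_eq)
  then have fb': "b < f b \<and> f b < g (f b)"
    using fb g_moves[of "f b"] f_id[of b'] by simp
  \<comment> \<open>The hypotheses do not say that \<open>g\<close> moves points beyond
    \<open>b'\<close>. What is needed is only that the orbit of \<open>b\<close> under
    \<open>s\<close> stays among the points moved by \<open>g\<close>.\<close>
  have orbit: "b < (s ^^ Suc l) b \<and> (s ^^ Suc l) b < g ((s ^^ Suc l) b)" for l
  proof (induction l)
    case 0
    show ?case using s_moved[OF fb'] by simp
  next
    case (Suc l)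
    then show ?case using s_moved f_moved by simp
  qed
  have orbit_f: "b < f ((s ^^ l) b) \<and> f ((s ^^ l) b) < g (f ((s ^^ l) b))" for l
  proof (cases l)
    case (Suc l')
    then show ?thesis using f_moved orbit[of l'] by blast
  qed (use fb' in simp)
  have b_le: "b \<le> (s ^^ l) b" for l
    using orbit by (cases l) (auto intro: less_imp_le)
  have b'_le: "b' \<le> (s ^^ Suc l) b" for l
  proof (induction l)
    case (Suc l)
    then show ?case using s_le[of "(s ^^ Suc l) b"] by simp
  qed (use gf in \<open>simp add: s_def\<close>)
  have w_moves: "(s ^^ l) b < w m ((s ^^ l) b)" if "m < l" for m l
    using that
  proof (induction m arbitrary: l)
    case 0
    then show ?case using orbit by (cases l) (auto simp: w0)
  next
    case (Suc m)
    then obtain l' where "l = Suc l'" "m < l'" by (cases l) auto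
    then show ?case using Suc.IH mono by (simp add: sw strict_mono_less)
  qed
  \<comment> \<open>The supports are disjoint: \<open>f\<close> is the identity from
    \<open>b'\<close> on, and \<open>w (Suc m)\<close> is the identity up to
    \<open>(s ^^ Suc m) b\<close>, which is at least \<open>b'\<close>.\<close>
  have f_comm: "f (w (Suc m) t) = w (Suc m) (f t)" for m t
  proof (cases "t \<le> b'")
    case True
    then have "f t \<le> f b'" using mono by (simp add: strict_mono_less_eq)
    then have "f t \<le> (s ^^ Suc m) b" "t \<le> (s ^^ Suc m) b"
      using b'_le[of m] True f_id[of b'] by linarith+
    then show ?thesis by (simp only: w_id)
  next
    case False
    then have "b' \<le> w (Suc m) t" "b' \<le> t" using w_le[of t "Suc m"] by linarith+
    then show ?thesis by (simp only: f_id)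
  qed
  \<comment> \<open>For \<open>i = 0\<close>, \<open>f\<close> commutes with \<open>w j\<close>, so
    conjugating \<open>w j\<close> by \<open>g\<close> has the same effect as conjugating it by
    \<open>s = g \<circ> f\<close>. Larger \<open>i\<close> follow by conjugating with
    \<open>s\<close>.\<close>
  have shift_w: "w i (w j t) = w (Suc j) (w i t)" if "i < j" for i j t
    using that
  proof (induction i arbitrary: j t)
    case 0
    then obtain j' where j: "j = Suc j'" by (cases j) auto
    obtain u where u: "t = f u" using homeo_plusD(2)[OF f] by auto
    have "g (w j (f u)) = s (w j u)"
      using f_comm[of j' u] by (simp add: s_def j)
    also have "\<dots> = w (Suc j) (g (f u))"
      using sw[of j u] by (simp add: s_def)
    finally show ?case by (simp add: w0 u)
  next
    case (Suc i)
    then obtain j' where j: "j = Suc j'" "i < j'" by (cases j) auto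
    obtain u where u: "t = s u" using surj_s by auto
    show ?case using Suc.IH[OF j(2)] by (simp add: u j sw)
  qed
  have "brown_thompson 1 \<cong> subgroup_generated homeo_plus (range z)"
  proof (rule brown_thompson_iso)
    show "z i \<in> carrier homeo_plus" for i
      by (cases i) (simp_all add: z_def)
    show "z i \<circ> z j = z (j + 1) \<circ> z i" if "i < j" for i j
      using that by (cases i; cases j) (auto simp: z_def fun_eq_iff sw shift_w)
    show "t \<le> z i t" for i t
      by (cases i) (simp_all add: z_def s_le w_le)
    show "d l < z j (d l)" if "j < l" for j l
    proof -
      obtain l' where l: "l = Suc l'" using \<open>j < l\<close> by (cases l) auto
      have "(s ^^ l') b < s ((s ^^ l') b)"
        using orbit_f[of l'] f_le[of "(s ^^ l') b"] by (simp add: s_def)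
      then show ?thesis
        using that w_moves by (cases j) (auto simp: z_def d_def l)
    qed
    show "z j (d l) = d l" if "l \<le> j" for j l
    proof (cases j)
      case 0
      then show ?thesis
        using that fa g_id[of a] ab by (simp add: z_def d_def s_def)
    next
      case (Suc m)
      have "d l \<le> (s ^^ m) b"
      proof (cases l)
        case 0
        then show ?thesis using ab b_le[of m] by (simp add: d_def)
      next
        case (Suc l')
        then obtain r where "m = l' + r" using \<open>j = Suc m\<close> \<open>l \<le> j\<close> by (metis Suc_le_mono le_Suc_ex)
        then show ?thesis
          using b_le[of r] by (simp add: d_def Suc funpow_add funpow_le_funpow_iff mono)
      qed
      then show ?thesis by (simp add: z_def Suc w_id)
    qed
  qed
  moreover have "subgroup_generated homeo_plus (range z) = subgroup_generated homeo_plus {f, g}"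
  proof (rule H.subgroup_generated_eqI)
    show "range z \<subseteq> carrier homeo_plus"
      by (auto simp: z_def split: nat.split)
    show "{f, g} \<subseteq> carrier homeo_plus"
      using f g by simp
    have fg: "f \<in> generate homeo_plus {f, g}" "g \<in> generate homeo_plus {f, g}"
      by (simp_all add: generate.incl)
    then have sg: "s \<in> generate homeo_plus {f, g}"
      using generate.eng[OF fg(2,1)] by (simp add: s_def)
    have wg: "w m \<in> generate homeo_plus {f, g}" for m
    proof (induction m)
      case (Suc m)
      have "inv\<^bsub>homeo_plus\<^esub> s \<in> generate homeo_plus {f, g}"
        using H.generate_m_inv_closed[OF _ sg] f g by simp
      then show ?case
        using generate.eng[OF generate.eng[OF sg Suc]] unfolding wS homeo_plus_mult by blast
    qed (simp add: w0 fg)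
    show "range z \<subseteq> generate homeo_plus {f, g}"
      using sg wg by (auto simp: z_def split: nat.split)
    have "z 0 \<in> generate homeo_plus (range z)" "inv\<^bsub>homeo_plus\<^esub> z 1 \<in> generate homeo_plus (range z)"
      "z 1 \<in> generate homeo_plus (range z)"
      by (auto intro: generate.incl generate.inv)
    moreover have "inv\<^bsub>homeo_plus\<^esub> z 1 \<otimes>\<^bsub>homeo_plus\<^esub> z 0 = f"
      by (simp add: z_def w0 fun_eq_iff s_def g)
    ultimately show "{f, g} \<subseteq> generate homeo_plus (range z)"
      using generate.eng by (fastforce simp: z_def w0)
  qed
  ultimately show ?thesis
    unfolding thompson_F_eq using group.iso_sym[OF group_presented_group] by metis
qed


section \<open>Abelianizations\<close>

text \<open>The kernel contains the derived subgroup because \<open>A\<close> is commutative, so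
  only the reverse inclusion is assumed before the first isomorphism theorem is applied.\<close>

lemma abelianization_isoI:
  assumes "group G" "comm_group A" "\<phi> \<in> hom G A" "\<phi> ` carrier G = carrier A"
    and ker: "kernel G A \<phi> \<subseteq> derived G (carrier G)"
  shows "abelianization G \<cong> A"
proof -
  interpret A: comm_group A by fact
  interpret \<phi>: group_hom G A \<phi>
    using assms by (simp add: group_hom_def group_hom_axioms_def A.group_axioms)
  have "\<phi> ` derived G (carrier G) = {\<one>\<^bsub>A\<^esub>}"
    using \<phi>.derived_img[of "carrier G"] A.derived_eq_singleton[of "carrier A"] assms(4) by simp
  then have "derived G (carrier G) \<subseteq> kernel G A \<phi>"
    using \<phi>.derived_in_carrier[of "carrier G"] by (auto simp: kernel_def)
  then have "kernel G A \<phi> = derived G (carrier G)"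
    using ker by blast
  then show ?thesis
    unfolding abelianization_def using \<phi>.FactGroup_iso[OF assms(4)] by simp
qed

definition ab_proj :: "('a, 'b) monoid_scheme \<Rightarrow> 'a \<Rightarrow> 'a set" where
  "ab_proj G x = derived G (carrier G) #>\<^bsub>G\<^esub> x"

context group
begin

lemma ab_proj_hom: "ab_proj G \<in> hom G (abelianization G)"
  unfolding ab_proj_def abelianization_def
  by (intro normal.r_coset_hom_Mod derived_is_normal normal_self)

lemma ab_proj_surj: "ab_proj G ` carrier G = carrier (abelianization G)"
  by (auto simp: ab_proj_def abelianization_def FactGroup_def RCOSETS_def)

lemma ab_proj_kernel:
  assumes "x \<in> carrier G" "ab_proj G x = \<one>\<^bsub>abelianization G\<^esub>"
  shows "x \<in> derived G (carrier G)"
  using assms coset_join1[of "derived G (carrier G)" x] derived_in_carrier[of "carrier G"]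
    derived_is_subgroup[of "carrier G"]
  by (auto simp: ab_proj_def abelianization_def FactGroup_def)

end

lemma abelianization_cong:
  assumes "group G" "group H" "G \<cong> H"
  shows "abelianization G \<cong> abelianization H"
proof -
  interpret G: group G by fact
  interpret H: group H by fact
  obtain \<theta> where \<theta>: "\<theta> \<in> iso G H"
    using assms(3) by (auto simp: is_iso_def)
  then interpret \<theta>: group_hom G H \<theta>
    by unfold_locales (simp add: iso_def)
  have \<theta>_bij: "\<theta> ` carrier G = carrier H" "inj_on \<theta> (carrier G)"
    using \<theta> by (auto simp: iso_def bij_betw_def)
  show ?thesis
  proof (rule abelianization_isoI)
    show "ab_proj H \<circ> \<theta> \<in> hom G (abelianization H)"
      by (rule hom_compose[OF \<theta>.homh H.ab_proj_hom])
    show "(ab_proj H \<circ> \<theta>) ` carrier G = carrier (abelianization H)"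
      unfolding image_comp[symmetric] \<theta>_bij(1) by (rule H.ab_proj_surj)
    show "kernel G (abelianization H) (ab_proj H \<circ> \<theta>) \<subseteq> derived G (carrier G)"
    proof
      fix x assume "x \<in> kernel G (abelianization H) (ab_proj H \<circ> \<theta>)"
      then have x: "x \<in> carrier G" "\<theta> x \<in> derived H (\<theta> ` carrier G)"
        using H.ab_proj_kernel \<theta>_bij(1) by (auto simp: kernel_def)
      then have "\<theta> x \<in> \<theta> ` derived G (carrier G)"
        using \<theta>.derived_img[of "carrier G"] by simp
      then show "x \<in> derived G (carrier G)"
        using x(1) \<theta>_bij(2) G.derived_in_carrier[of "carrier G"] by (auto simp: inj_on_def)
    qed
  qed (use assms comm_group_abelianization in auto)
qed

text \<open>Periodicity starts at 1 because conjugation by the generator of index 0 shifts only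
  positive indices. \<open>P\<close> will be both a class in the abelianization and membership in a
  subgroup.\<close>

lemma periodic_reduce:
  fixes P :: "nat \<Rightarrow> 'a"
  assumes "\<And>j. 1 \<le> j \<Longrightarrow> P (j + p) = P j" "0 < p" "1 \<le> j"
  shows "P j = P (1 + (j - 1) mod p)"
  using assms(3)
proof (induction j rule: less_induct)
  case (less j)
  show ?case
  proof (cases "j \<le> p")
    case True
    then show ?thesis using less.prems by simp
  next
    case False
    then have "P j = P (j - p)" "1 \<le> j - p" "j - p < j"
      using assms(1)[of "j - p"] \<open>0 < p\<close> by auto
    moreover have "(j - p - 1) mod p = (j - 1) mod p"
      using False mod_add_self2[of "j - p - 1" p] by (simp add: Suc_diff_le[symmetric])
    ultimately show ?thesis using less.IH by metis
  qed
qed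

section \<open>Free abelian groups and the abelianization of the Brown--Thompson group\<close>

abbreviation free_abelian :: "nat \<Rightarrow> (nat \<Rightarrow> int) monoid" where
  "free_abelian k \<equiv> product_group {1..k} (\<lambda>_. integer_group)"

text \<open>The restriction is there because the carrier of \<open>product_group\<close> consists of
  extensional functions.\<close>

definition unit_vec :: "nat \<Rightarrow> nat \<Rightarrow> nat \<Rightarrow> int" where
  "unit_vec k r = (\<lambda>i\<in>{1..k}. if i = r then 1 else 0)"

lemma unit_vec_closed [simp]: "unit_vec k r \<in> carrier (free_abelian k)"
  by (simp add: unit_vec_def)

lemma comm_group_free_abelian: "comm_group (free_abelian k)"
proof -
  interpret group "free_abelian k" by simp
  show ?thesis
    by (rule group_comm_groupI) (auto simp: add.commute)
qed

lemma free_abelian_int_pow: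
  assumes "v \<in> carrier (free_abelian k)" "i \<in> {1..k}"
  shows "(v [^]\<^bsub>free_abelian k\<^esub> (m :: int)) i = m * v i"
proof -
  have "(\<lambda>v. v i) \<in> hom (free_abelian k) integer_group"
    using assms(2) by (auto simp: hom_def)
  then interpret group_hom "free_abelian k" integer_group "\<lambda>v. v i"
    by (simp add: group_hom_def group_hom_axioms_def)
  show ?thesis
    using hom_int_pow[OF assms(1), of m] by simp
qed

text \<open>The vectors supported on the first \<open>m\<close> coordinates are handled by induction
  on \<open>m\<close>, the last coordinate being split off as a power of a unit vector.\<close>

lemma subgroup_free_abelian_eq:
  assumes "subgroup S (free_abelian k)" "\<And>r. r \<in> {1..k} \<Longrightarrow> unit_vec k r \<in> S"
  shows "S = carrier (free_abelian k)"
proof -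
  interpret Z: group "free_abelian k" by simp
  have "m \<le> k \<Longrightarrow> v \<in> carrier (free_abelian k) \<Longrightarrow> \<forall>i\<in>{1..k}. m < i \<longrightarrow> v i = 0 \<Longrightarrow> v \<in> S" for m v
  proof (induction m arbitrary: v)
    case 0
    then have "v = \<one>\<^bsub>free_abelian k\<^esub>"
      by (auto simp: PiE_iff extensional_def fun_eq_iff)
    then show ?case using subgroup.one_closed[OF assms(1)] by metis
  next
    case (Suc m)
    define u where "u = (\<lambda>i\<in>{1..k}. if i = Suc m then 0 else v i)"
    define a where "a = unit_vec k (Suc m) [^]\<^bsub>free_abelian k\<^esub> v (Suc m)"
    have "u \<in> S"
      using Suc.prems by (intro Suc.IH) (auto simp: u_def)
    moreover have "a \<in> S"
      unfolding a_def using Suc.prems(1) by (intro Z.subgroup_int_pow_closed assms) auto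
    moreover have "u \<otimes>\<^bsub>free_abelian k\<^esub> a = v"
    proof
      fix i
      show "(u \<otimes>\<^bsub>free_abelian k\<^esub> a) i = v i"
      proof (cases "i \<in> {1..k}")
        case True
        have "a i = v (Suc m) * unit_vec k (Suc m) i"
          unfolding a_def using True by (rule free_abelian_int_pow[OF unit_vec_closed])
        then show ?thesis using True by (simp add: u_def unit_vec_def)
      next
        case False
        then have "v i = undefined"
          using Suc.prems(2) by (auto simp: PiE_iff extensional_def)
        then show ?thesis using False by auto
      qed
    qed
    ultimately show ?case
      using subgroup.m_closed[OF assms(1)] by metis
  qed
  from this[of k] show ?thesis
    using subgroup.subset[OF assms(1)] by auto
qed

lemma (in comm_group) free_abelian_hom:
  assumes a: "\<And>r. a r \<in> carrier G"
  obtains h where "h \<in> hom (free_abelian k) G" "\<And>r. r \<in> {1..k} \<Longrightarrow> h (unit_vec k r) = a r"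
proof
  define h where "h = (\<lambda>v :: nat \<Rightarrow> int. finprod G (\<lambda>r. a r [^] v r) {1..k})"
  show "h \<in> hom (free_abelian k) G"
  proof (rule homI)
    show "h v \<in> carrier G" for v
      using a by (auto simp: h_def intro: finprod_closed)
    fix u v :: "nat \<Rightarrow> int"
    have "h (u \<otimes>\<^bsub>free_abelian k\<^esub> v) = finprod G (\<lambda>r. a r [^] u r \<otimes> a r [^] v r) {1..k}"
      unfolding h_def using a by (intro finprod_cong) (auto simp: int_pow_mult simp_implies_def)
    also have "\<dots> = h u \<otimes> h v"
      unfolding h_def using a by (intro finprod_multf) auto
    finally show "h (u \<otimes>\<^bsub>free_abelian k\<^esub> v) = h u \<otimes> h v" .
  qed
  fix r assume r: "r \<in> {1..k}"
  have "h (unit_vec k r) = finprod G (\<lambda>i. if r = i then a i else \<one>) {1..k}"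
    unfolding h_def using a by (intro finprod_cong) (auto simp: unit_vec_def int_pow_1 simp_implies_def)
  also have "\<dots> = a r"
    using r a by (intro finprod_singleton) auto
  finally show "h (unit_vec k r) = a r" .
qed

text \<open>After abelianizing, the relations say that the class of generator \<open>j\<close>
  equals that of \<open>j + p\<close> for \<open>j >= 1\<close>. Generator 0 stays alone, and the
  others fall into \<open>p\<close> classes. The map \<open>\<phi>\<close> to the free abelian group
  has its kernel controlled by a map \<open>\<sigma>\<close> back to the abelianization.\<close>

lemma abelianization_brown_thompson:
  assumes "0 < p"
  shows "abelianization (brown_thompson p) \<cong> free_abelian (p + 1)"
proof -
  define P where "P = brown_thompson p"
  define x where "x = pgen (brown_thompson_rel p)"
  define Z where "Z = free_abelian (p + 1)"
  define A where "A = abelianization P"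
  \<comment> \<open>Coordinate 1 belongs to generator 0, and coordinates 2 to \<open>p + 1\<close>
    to the residues of \<open>j - 1\<close> modulo \<open>p\<close>; generator \<open>r - 1\<close>
    thus represents coordinate \<open>r\<close>.\<close>
  define cls where "cls = (\<lambda>j. if j = 0 then 1 else 2 + (j - 1) mod p)"
  define e where "e = (\<lambda>j. unit_vec (p + 1) (cls j))"
  interpret P: group P unfolding P_def by (rule group_presented_group)
  interpret Z: comm_group Z unfolding Z_def by (rule comm_group_free_abelian)
  interpret A: comm_group A unfolding A_def by (rule comm_group_abelianization[OF P.group_axioms])
  have x [simp]: "x j \<in> carrier P" for j by (simp add: x_def P_def)
  have e [simp]: "e j \<in> carrier Z" for j unfolding e_def Z_def by (rule unit_vec_closed)
  have cls: "cls j \<in> {1..p + 1}" for j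
    using assms mod_less_divisor[of p "j - 1"] by (auto simp: cls_def simp del: mod_less_divisor)
  have e_shift: "e (j + p) = e j" if "1 \<le> j" for j
  proof -
    have "(j + p - 1) mod p = (j - 1) mod p"
      using that by (metis Nat.add_diff_assoc2 mod_add_self2)
    then show ?thesis using that by (simp add: e_def cls_def)
  qed
  have "word_val Z e l = word_val Z e r" if "(l, r) \<in> brown_thompson_rel p" for l r
    using that e_shift Z.m_comm[of "e _" "e _"]
    by (auto simp: brown_thompson_rel_def Z.m_assoc[symmetric])
  then obtain \<phi> where "\<phi> \<in> hom P Z" and \<phi>w: "\<And>w. \<phi> (word_class (brown_thompson_rel p) w) = word_val Z e w"
    using Z.presented_group_hom[of e "brown_thompson_rel p"] e unfolding P_def by metis
  then interpret \<phi>: group_hom P Z \<phi> by unfold_locales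
  have \<phi>x: "\<phi> (x j) = e j" for j
    unfolding x_def pgen_def \<phi>w by simp
  interpret q: group_hom P A "ab_proj P"
    using P.ab_proj_hom P.group_axioms A.group_axioms
    by (simp add: A_def group_hom_def group_hom_axioms_def)
  define a where "a = (\<lambda>r. ab_proj P (x (r - 1)))"
  have "a r \<in> carrier A" for r by (simp add: a_def)
  then obtain \<sigma> where \<sigma>: "\<sigma> \<in> hom Z A" "\<And>r. r \<in> {1..p + 1} \<Longrightarrow> \<sigma> (unit_vec (p + 1) r) = a r"
    using A.free_abelian_hom[of a "p + 1"] unfolding Z_def by metis
  interpret \<sigma>: group_hom Z A \<sigma> using \<sigma>(1) by unfold_locales
  have q_shift: "ab_proj P (x (j + p)) = ab_proj P (x j)" if "1 \<le> j" for j
  proof -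
    interpret B: shift_family P "\<lambda>i. inv\<^bsub>P\<^esub> x i" p
      unfolding P_def x_def by (rule shift_family_brown_thompson)
    have "ab_proj P (inv\<^bsub>P\<^esub> x 0 \<otimes>\<^bsub>P\<^esub> inv\<^bsub>P\<^esub> x j) = ab_proj P (inv\<^bsub>P\<^esub> x (j + p) \<otimes>\<^bsub>P\<^esub> inv\<^bsub>P\<^esub> x 0)"
      using B.shift[of 0 j] that by simp
    then have "inv\<^bsub>A\<^esub> ab_proj P (x j) = inv\<^bsub>A\<^esub> ab_proj P (x (j + p))"
      by (simp add: A.m_comm)
    then show ?thesis
      using A.inv_inv q.hom_closed x by metis
  qed
  have \<sigma>e: "\<sigma> (e j) = ab_proj P (x j)" for j
  proof (cases "j = 0")
    case False
    then have "ab_proj P (x j) = ab_proj P (x (1 + (j - 1) mod p))"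
      using periodic_reduce[of "\<lambda>j. ab_proj P (x j)" p j] q_shift assms by simp
    then show ?thesis
      using \<sigma>(2)[OF cls[of j]] False by (simp add: e_def a_def cls_def)
  qed (use \<sigma>(2)[OF cls[of 0]] in \<open>simp add: e_def a_def cls_def\<close>)
  have "abelianization P \<cong> Z"
  proof (rule abelianization_isoI)
    show "\<phi> ` carrier P = carrier Z"
      unfolding Z_def
    proof (rule subgroup_free_abelian_eq)
      show "subgroup (\<phi> ` carrier P) (free_abelian (p + 1))"
        using \<phi>.img_is_subgroup by (simp add: Z_def)
      fix r assume r: "r \<in> {1..p + 1}"
      have "cls (r - 1) = r"
        using r by (auto simp: cls_def)
      then have "unit_vec (p + 1) r = \<phi> (x (r - 1))"
        by (simp add: \<phi>x e_def)
      then show "unit_vec (p + 1) r \<in> \<phi> ` carrier P" by simp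
    qed
    show "kernel P Z \<phi> \<subseteq> derived P (carrier P)"
    proof
      fix g assume "g \<in> kernel P Z \<phi>"
      then have g: "g \<in> carrier P" "\<phi> g = \<one>\<^bsub>Z\<^esub>" by (auto simp: kernel_def)
      obtain w where w: "g = word_val P x w"
        using g(1) carrier_presented_groupE unfolding P_def x_def by blast
      \<comment> \<open>\<open>\<sigma> \<circ> \<phi>\<close> and the projection agree on
        generators, hence on \<open>g\<close>; so \<open>\<phi> g\<close> being trivial forces
        \<open>g\<close> into the derived subgroup.\<close>
      have "\<sigma> (\<phi> g) = word_val A (\<sigma> \<circ> (\<phi> \<circ> x)) w"
        by (simp add: w \<phi>.hom_word_val \<sigma>.hom_word_val)
      also have "\<sigma> \<circ> (\<phi> \<circ> x) = ab_proj P \<circ> x"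
        by (simp add: fun_eq_iff \<phi>x \<sigma>e)
      also have "word_val A \<dots> w = ab_proj P g"
        by (simp add: w q.hom_word_val)
      finally show "g \<in> derived P (carrier P)"
        using g P.ab_proj_kernel by (simp add: A_def[symmetric])
    qed
  qed (auto intro: P.group_axioms Z.comm_group_axioms \<phi>.homh)
  then show ?thesis by (simp add: P_def Z_def)
qed


section \<open>The chain group\<close>

text \<open>The clamp joins the three affine pieces in one formula; the middle one has slope
  \<open>p + 1\<close>.\<close>

definition step_map :: "nat \<Rightarrow> nat \<Rightarrow> real \<Rightarrow> real" where
  "step_map p j t = t + real p * max 0 (min 1 (t - real j))"

lemma step_map_id [simp]: "t \<le> real j \<Longrightarrow> step_map p j t = t"
  by (simp add: step_map_def)

lemma step_map_far: "real j + 1 \<le> t \<Longrightarrow> step_map p j t = t + real p"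
  by (simp add: step_map_def)

lemma step_map_le: "t \<le> step_map p j t"
  by (simp add: step_map_def)

lemma step_map_antimono: "i \<le> j \<Longrightarrow> step_map p j t \<le> step_map p i t"
  by (auto simp: step_map_def intro!: mult_left_mono)

lemma step_map_strict_mono: "strict_mono (step_map p j)"
proof (rule strict_monoI)
  fix s t :: real assume "s < t"
  then have "real p * max 0 (min 1 (s - real j)) \<le> real p * max 0 (min 1 (t - real j))"
    by (intro mult_left_mono) auto
  then show "step_map p j s < step_map p j t"
    using \<open>s < t\<close> by (simp add: step_map_def)
qed

lemma step_map_homeo_plus [simp]: "step_map p j \<in> carrier homeo_plus"
proof -
  \<comment> \<open>The explicit inverse: slope \<open>1 / (p + 1)\<close> on
    \<open>[j, j + p + 1]\<close>, the image of \<open>[j, j + 1]\<close>.\<close>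
  define g where "g = (\<lambda>t. t - real p * max 0 (min 1 ((t - real j) / (real p + 1))))"
  have "g (step_map p j t) = t" for t
  proof -
    consider "t \<le> real j" | "real j \<le> t" "t \<le> real j + 1" | "real j + 1 \<le> t" by linarith
    then show ?thesis
    proof cases
      case 2
      then have "step_map p j t - real j = (real p + 1) * (t - real j)"
        by (simp add: step_map_def algebra_simps)
      then have "(step_map p j t - real j) / (real p + 1) = t - real j"
        by simp
      then show ?thesis using 2 by (simp add: g_def step_map_def)
    qed (simp_all add: g_def step_map_far divide_nonpos_pos)
  qed
  moreover have "step_map p j (g t) = t" for t
  proof -
    define u where "u = (t - real j) / (real p + 1)"
    have t: "t = real j + (real p + 1) * u" by (simp add: u_def)
    consider "u \<le> 0" | "0 \<le> u" "u \<le> 1" | "1 \<le> u" by linarith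
    then show ?thesis
    proof cases
      case 1
      then have "(real p + 1) * u \<le> 0" by (simp add: mult_nonneg_nonpos)
      then show ?thesis using 1 by (simp add: g_def u_def[symmetric], simp add: t)
    next
      case 2
      then have "g t = real j + u" by (simp add: g_def u_def[symmetric], simp add: t algebra_simps)
      then show ?thesis using 2 by (simp add: step_map_def, simp add: t algebra_simps)
    next
      case 3
      then have "real p * 1 \<le> real p * u" by (intro mult_left_mono) auto
      then have "real j + 1 \<le> t - real p" using 3 by (simp add: t algebra_simps)
      then show ?thesis
        using 3 by (simp add: g_def u_def[symmetric] step_map_far)
    qed
  qed
  moreover have "continuous_on UNIV (step_map p j)" "continuous_on UNIV g"
    unfolding step_map_def g_def by (intro continuous_intros; simp)+
  ultimately have "homeomorphism UNIV UNIV (step_map p j) g"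
    by (auto simp: homeomorphism_def image_iff) (metis, metis)
  then show ?thesis
    using step_map_strict_mono by (auto simp: homeo_plus_def)
qed

lemma step_map_less:
  assumes "0 < p" "real j < t"
  shows "t < step_map p j t"
  using assms by (simp add: step_map_def)

text \<open>Right of \<open>j\<close> the map of index \<open>i\<close> is translation by
  \<open>p\<close>, which carries the step at \<open>j\<close> to the step at \<open>j + p\<close>.
  Left of \<open>j\<close> both sides reduce to the map of index \<open>i\<close>, whose values
  there are at most \<open>j + p\<close>.\<close>

lemma step_map_shift:
  assumes "i < j"
  shows "step_map p i \<circ> step_map p j = step_map p (j + p) \<circ> step_map p i"
proof
  fix t
  have ij: "real i + 1 \<le> real j" using assms by simp
  show "(step_map p i \<circ> step_map p j) t = (step_map p (j + p) \<circ> step_map p i) t"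
  proof (cases "t \<le> real j")
    case True
    have "step_map p i t \<le> t + real p"
      by (auto simp: step_map_def intro: mult_left_le)
    then show ?thesis using True by simp
  next
    case False
    then have "real i + 1 \<le> step_map p j t"
      using step_map_le[of t p j] ij by linarith
    then have "step_map p i (step_map p j t) = step_map p j t + real p"
      by (rule step_map_far)
    moreover have "step_map p i t = t + real p"
      using False ij by (intro step_map_far) simp
    moreover have "step_map p (j + p) (t + real p) = step_map p j t + real p"
      by (simp add: step_map_def)
    ultimately show ?thesis by simp
  qed
qed

text \<open>Far to the right both step maps are the same translation, so the quotient is the
  identity there: this cuts the support down to a bounded interval.\<close>

definition bump_map :: "nat \<Rightarrow> nat \<Rightarrow> nat \<Rightarrow> real \<Rightarrow> real" where
  "bump_map p i j = step_map p i \<circ> inv\<^bsub>homeo_plus\<^esub> step_map p j"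

lemma bump_map_homeo_plus [simp]: "bump_map p i j \<in> carrier homeo_plus"
  using group.is_monoid[OF group_homeo_plus]
    monoid.m_closed[of homeo_plus "step_map p i" "inv\<^bsub>homeo_plus\<^esub> step_map p j"]
    group.inv_closed[OF group_homeo_plus]
  by (simp add: bump_map_def comp_def)

lemma bump_map_step_map [simp]: "bump_map p i j (step_map p j t) = step_map p i t"
  by (simp add: bump_map_def)

lemma bump_map_left: "t \<le> real j \<Longrightarrow> bump_map p i j t = step_map p i t"
  using bump_map_step_map[of p i j t] by (simp del: bump_map_step_map)

lemma bump_map_le:
  assumes "i \<le> j"
  shows "t \<le> bump_map p i j t"
proof -
  obtain s where "t = step_map p j s"
    using homeo_plusD(2)[OF step_map_homeo_plus, of p j] by auto
  then show ?thesis using assms by (simp add: step_map_antimono)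
qed

text \<open>With \<open>t = step_map p j s\<close>, the point \<open>t\<close> moves exactly when
  the two step maps differ at \<open>s\<close>, that is, for \<open>i < s < j + 1\<close>. The map
  of index \<open>j\<close> fixes \<open>i\<close> and sends \<open>j + 1\<close> to
  \<open>j + p + 1\<close>.\<close>

lemma supp_bump_map:
  assumes "0 < p" "i < j"
  shows "supp (bump_map p i j) = {real i<..<real j + real p + 1}"
proof -
  have ij: "real i + 1 \<le> real j" using assms by simp
  have "bump_map p i j t \<noteq> t \<longleftrightarrow> real i < t \<and> t < real j + real p + 1" for t
  proof -
    obtain s where s: "t = step_map p j s"
      using homeo_plusD(2)[OF step_map_homeo_plus, of p j] by auto
    have "bump_map p i j t \<noteq> t \<longleftrightarrow> max 0 (min 1 (s - real i)) \<noteq> max 0 (min 1 (s - real j))"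
      unfolding s bump_map_step_map using assms by (simp add: step_map_def)
    also have "\<dots> \<longleftrightarrow> real i < s \<and> s < real j + 1"
      using ij by (auto simp: max_def min_def)
    also have "\<dots> \<longleftrightarrow> step_map p j (real i) < t \<and> t < step_map p j (real j + 1)"
      unfolding s by (simp only: strict_mono_less[OF step_map_strict_mono])
    also have "\<dots> \<longleftrightarrow> real i < t \<and> t < real j + real p + 1"
      using ij by (simp add: step_map_far algebra_simps)
    finally show ?thesis .
  qed
  then show ?thesis
    by (simp only: supp_def set_eq_iff mem_Collect_eq greaterThanLessThan_iff simp_thms)
qed

lemma supp_step_map:
  assumes "0 < p"
  shows "supp (step_map p j) = {real j<..}"
proof -
  have "step_map p j t \<noteq> t \<longleftrightarrow> real j < t" for t
    using step_map_less[OF assms, of j t] by (cases "real j < t") auto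
  then show ?thesis by (auto simp: supp_def)
qed

lemma left_endpoint_greaterThanLessThan: "a < b \<Longrightarrow> left_endpoint {a<..<b} = ereal a"
  unfolding left_endpoint_def by (subst ereal_Inf'[symmetric]) (auto intro: bdd_belowI)

lemma left_endpoint_greaterThan: "left_endpoint {a<..} = ereal a"
  unfolding left_endpoint_def by (subst ereal_Inf'[symmetric]) (auto intro: bdd_belowI)

text \<open>Consecutive intervals overlap between \<open>c i\<close> and \<open>c (i + 1)\<close>,
  and these two grid points witness properness, each lying in only one of the two intervals.\<close>

lemma chain_of_intervals_grid:
  fixes c :: "nat \<Rightarrow> real"
  assumes c: "strict_mono c"
    and J: "\<And>i. i \<in> {1..n} \<Longrightarrow> J i = (if i < n then {c (i - 1)<..<c (i + 1)} else {c (i - 1)<..})"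
  shows "chain_of_intervals n J"
proof -
  have mem: "x \<in> J i \<longleftrightarrow> c (i - 1) < x \<and> (i < n \<longrightarrow> x < c (i + 1))" if "i \<in> {1..n}" for i x
    using J[OF that] by auto
  have le: "c i \<le> c j \<longleftrightarrow> i \<le> j" and less: "c i < c j \<longleftrightarrow> i < j" for i j
    using c by (simp_all add: strict_mono_less_eq strict_mono_less)
  have int: "is_interval (J i)" if "i \<in> {1..n}" for i
    using J[OF that] by (simp add: is_interval_oo is_interval_oi)
  have disj: "J i \<inter> J l = {}" if "i \<in> {1..n}" "l \<in> {1..n}" "i + 1 < l" for i l
  proof -
    have "c (i + 1) \<le> c (l - 1)" using that by (simp add: le)
    then have "x \<notin> J l" if "x \<in> J i" for x
      using that mem[of i x] mem[of l x] \<open>i \<in> {1..n}\<close> \<open>l \<in> {1..n}\<close> \<open>i + 1 < l\<close> by auto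
    then show ?thesis by blast
  qed
  have overlap: "J i \<inter> J (i + 1) \<noteq> {} \<and> J i \<inter> J (i + 1) \<subset> J i \<and> J i \<inter> J (i + 1) \<subset> J (i + 1)" if "i \<in> {1..<n}" for i
  proof -
    have cs: "c (i - 1) < c i" "c i < c (i + 1)" "c (i + 1) < c (i + 2)"
      using that by (simp_all add: less)
    obtain x where x: "c i < x" "x < c (i + 1)" using dense[OF cs(2)] by blast
    have "x \<in> J i \<inter> J (i + 1)" "c i \<in> J i - J (i + 1)" "c (i + 1) \<in> J (i + 1) - J i"
      using that cs x by (auto simp: mem)
    then show ?thesis by blast
  qed
  have "J i \<noteq> {} \<and> open (J i)" if "i \<in> {1..n}" for i
  proof -
    have "c (i - 1) < c (i + 1)" by (rule less[THEN iffD2]) linarith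
    then show ?thesis using J[OF that] by simp
  qed
  moreover have "J i \<inter> J l = {}" if "i \<in> {1..n}" "l \<in> {1..n}" "1 < \<bar>int i - int l\<bar>" for i l
    using disj[of i l] disj[of l i] that by (cases "i < l") auto
  ultimately show ?thesis
    unfolding chain_of_intervals_def using int overlap by (auto intro: is_interval_Int)
qed

lemma chain_group_brown_thompson:
  assumes p: "0 < p" and n: "p + 1 \<le> n"
  shows "chain_group n (subgroup_generated homeo_plus (range (step_map p)))"
proof -
  interpret H: group homeo_plus by (rule group_homeo_plus)
  define k where "k = p + 1"
  define y where "y = step_map p"
  define f where "f = (\<lambda>i. if i < n then bump_map p ((i - 1) * k) (i * k) else y ((i - 1) * k))"
  define c where "c = (\<lambda>i. real (i * k))"
  have k: "0 < k" by (simp add: k_def)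
  have c: "strict_mono c"
    using k by (auto simp: c_def strict_mono_def)
  have c_Suc: "c (i + 1) = c i + real p + 1" for i
    by (simp add: c_def k_def algebra_simps)
  have y [simp]: "y j \<in> carrier homeo_plus" for j
    by (simp add: y_def)
  have f_car [simp]: "f i \<in> carrier homeo_plus" for i
    by (simp add: f_def)
  have f_le: "t \<le> f i t" for i t
    by (simp add: f_def y_def step_map_le bump_map_le)
  \<comment> \<open>Left of \<open>c i\<close> the inverse factor of the bump is the identity, so
    images can be computed with \<open>y\<close> alone.\<close>
  have f_left: "f i t = y ((i - 1) * k) t" if "t \<le> c i" for i t
    using that by (simp add: f_def y_def c_def bump_map_left)
  have supp_f: "supp (f i) = (if i < n then {c (i - 1)<..<c (i + 1)} else {c (i - 1)<..})"
    if "i \<in> {1..n}" for i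
  proof -
    have "(i - 1) * k < i * k" using that k by simp
    then show ?thesis
      using p c_Suc[of i] by (simp add: f_def y_def supp_bump_map supp_step_map c_def)
  qed
  have moved: "t < f i t \<longleftrightarrow> t \<in> supp (f i)" for i t
    using f_le[of t i] by (auto simp: supp_def)
  have not_supp: "t \<notin> supp (f i) \<Longrightarrow> f i t = t" for i t
    by (simp add: supp_def)
  have endpoint: "left_endpoint (supp (f i)) = ereal (c (i - 1))" if "i \<in> {1..n}" for i
    using supp_f[OF that] c
    by (simp add: left_endpoint_greaterThan left_endpoint_greaterThanLessThan strict_mono_less)
  have pair: "subgroup_generated homeo_plus {f i, f (i + 1)} \<cong> thompson_F" if i: "i \<in> {1..<n}" for i
  proof (rule two_chain_thompson_F)
    have c3: "c (i - 1) < c i" "c i = c (i - 1) + real p + 1" "c (i + 1) = c i + real p + 1"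
      "c (i + 2) = c (i + 1) + real p + 1"
      using i c_Suc[of "i - 1"] c_Suc[of i] c_Suc[of "i + 1"] by (simp_all add: numeral_2_eq_2)
    have supp_i: "supp (f i) = {c (i - 1)<..<c (i + 1)}"
      "supp (f (i + 1)) = (if i + 1 < n then {c i<..<c (i + 2)} else {c i<..})"
      using supp_f[of i] supp_f[of "i + 1"] i by simp_all
    show "c (i - 1) < c i" by (fact c3)
    show "f i (c (i - 1)) = c (i - 1)" "\<And>t. c (i + 1) \<le> t \<Longrightarrow> f i t = t"
      by (simp_all add: not_supp supp_i)
    show "f (i + 1) t = t" if "t \<le> c i" for t
      by (rule not_supp) (use that supp_i(2) in simp)
    show "t < f (i + 1) t" if "c i < t" "t \<le> c (i + 1)" for t
      unfolding moved using supp_i(2) that c3 by simp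
    \<comment> \<open>Both maps translate by \<open>p\<close> here, so \<open>c i\<close> reaches
      \<open>c i + 2 * p\<close>, which is at least \<open>c (i + 1) = c i + p + 1\<close> because
      \<open>p >= 1\<close>.\<close>
    have fc: "f i (c i) = c i + real p"
      unfolding f_left[OF order_refl] y_def using c3 by (intro step_map_far) (simp add: c_def)
    then show "c i < f i (c i)" using p by simp
    have "f (i + 1) (c i + real p) = y (i * k) (c i + real p)"
      using f_left[of "c i + real p" "i + 1"] c3 by simp
    also have "\<dots> = c i + real p + real p"
      unfolding y_def using p by (intro step_map_far) (simp add: c_def)
    finally show "c (i + 1) \<le> f (i + 1) (f i (c i))"
      unfolding fc using p c3 by linarith
  qed (simp_all add: f_le)
  have "subgroup_generated homeo_plus (range y) = subgroup_generated homeo_plus (f ` {1..n})"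
  proof (rule H.subgroup_generated_eqI)
    show "f ` {1..n} \<subseteq> generate homeo_plus (range y)"
    proof -
      have "y i \<otimes>\<^bsub>homeo_plus\<^esub> inv\<^bsub>homeo_plus\<^esub> y j \<in> generate homeo_plus (range y)" for i j
        by (intro generate.eng generate.incl generate.inv) simp_all
      then have "bump_map p i j \<in> generate homeo_plus (range y)" for i j
        by (simp only: bump_map_def y_def homeo_plus_mult)
      then show ?thesis by (auto simp: f_def intro: generate.incl)
    qed
    define S where "S = generate homeo_plus (f ` {1..n})"
    have S: "subgroup S homeo_plus"
      unfolding S_def by (intro H.generate_is_subgroup) auto
    have f_S: "f i \<in> S" if "i \<in> {1..n}" for i
      unfolding S_def using that by (intro generate.incl) simp
    \<comment> \<open>Telescoping downwards from \<open>f n = y ((n - 1) * k)\<close>: multiplying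
      by \<open>f (m + 1)\<close> on the left turns \<open>y (Suc m * k)\<close> into
      \<open>y (m * k)\<close>.\<close>
    have grid: "y (m * k) \<in> S" if "m \<le> n - 1" for m
      using that
    proof (induction m rule: inc_induct)
      case base
      then show ?case using f_S[of n] n by (simp add: f_def)
    next
      case (step m)
      have "f (m + 1) \<otimes>\<^bsub>homeo_plus\<^esub> y (Suc m * k) = y (m * k)"
        using step.hyps by (simp add: f_def y_def bump_map_def fun_eq_iff)
      then show ?case
        using subgroup.m_closed[OF S f_S[of "m + 1"] step.IH] step.hyps by simp
    qed
    have y0: "y 0 \<in> S" "inv\<^bsub>homeo_plus\<^esub> y 0 \<in> S"
      using grid[of 0] subgroup.m_inv_closed[OF S] by simp_all
    \<comment> \<open>Conjugation by \<open>y 0\<close>, already known to lie in \<open>S\<close>,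
      shifts a positive index by \<open>p\<close>.\<close>
    have period: "(y (j + p) \<in> S) = (y j \<in> S)" if "1 \<le> j" for j
    proof -
      have sh: "y 0 \<otimes>\<^bsub>homeo_plus\<^esub> y j = y (j + p) \<otimes>\<^bsub>homeo_plus\<^esub> y 0"
        using step_map_shift[of 0 j p] that by (simp add: y_def)
      have "y (j + p) = y 0 \<otimes>\<^bsub>homeo_plus\<^esub> y j \<otimes>\<^bsub>homeo_plus\<^esub> inv\<^bsub>homeo_plus\<^esub> y 0"
        unfolding sh by (simp add: fun_eq_iff)
      moreover have "y j = inv\<^bsub>homeo_plus\<^esub> y 0 \<otimes>\<^bsub>homeo_plus\<^esub> (y (j + p) \<otimes>\<^bsub>homeo_plus\<^esub> y 0)"
        unfolding sh[symmetric] by (simp add: fun_eq_iff)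
      ultimately show ?thesis
        using subgroup.m_closed[OF S] y0 by metis
    qed
    have "y j \<in> S" for j
    proof (cases "j = 0")
      case False
      define r where "r = 1 + (j - 1) mod p"
      have r: "1 \<le> r" "r \<le> p"
        using mod_less_divisor[OF p, of "j - 1"] by (simp_all add: r_def)
      \<comment> \<open>As \<open>k = p + 1\<close>, the index \<open>r * k\<close> is congruent to
        \<open>r\<close> modulo \<open>p\<close>; the 1 is subtracted because
        \<open>periodic_reduce\<close> counts from 1. Since \<open>r <= p <= n - 1\<close>, the grid
        contains \<open>r * k\<close>.\<close>
      have "r * k - 1 = r * p + (r - 1)"
        using r by (simp add: k_def algebra_simps)
      then have "(r * k - 1) mod p = (r - 1) mod p"
        by (simp only: mod_mult_self3)
      then have "(r * k - 1) mod p = r - 1"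
        using r by simp
      then have "(y (r * k) \<in> S) = (y r \<in> S)"
        using periodic_reduce[of "\<lambda>j. y j \<in> S" p "r * k"] period p r k by simp
      moreover have "(y j \<in> S) = (y r \<in> S)"
        using periodic_reduce[of "\<lambda>j. y j \<in> S" p j] period p False by (simp add: r_def)
      ultimately show ?thesis using grid[of r] r n by simp
    qed (use y0 in simp)
    then show "range y \<subseteq> generate homeo_plus (f ` {1..n})"
      by (auto simp: S_def)
  qed auto
  moreover have "chain_of_intervals n (\<lambda>i. supp (f i))"
    by (rule chain_of_intervals_grid[OF c supp_f])
  moreover have "left_endpoint (supp (f i)) < left_endpoint (supp (f (i + 1)))" if "i \<in> {1..<n}" for i
    using endpoint[of i] endpoint[of "i + 1"] that c by (simp add: strict_mono_less)
  ultimately show ?thesis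
    unfolding chain_group_def using p n pair f_le by (auto simp: y_def intro!: exI[of _ f])
qed

theorem proposition1p6:
  fixes k n :: nat
  assumes "2 \<le> k" and "k \<le> n"
  shows "\<exists>G. chain_group n G \<and>
           abelianization G \<cong> product_group {1..k} (\<lambda>_. integer_group)"
proof -
  define p where "p = k - 1"
  \<comment> \<open>The group depends on \<open>k\<close> only; \<open>n\<close> enters through the
    choice of a generating chain.\<close>
  define G where "G = subgroup_generated homeo_plus (range (step_map p))"
  have p: "0 < p" "p + 1 = k" using assms by (simp_all add: p_def)
  interpret H: group homeo_plus by (rule group_homeo_plus)
  interpret A: comm_group "abelianization (brown_thompson p)"
    by (rule comm_group_abelianization[OF group_presented_group])
  have "brown_thompson p \<cong> G"
    unfolding G_def
  \<comment> \<open>The integer \<open>l\<close> is moved by the step maps of index below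
    \<open>l\<close> and fixed by all others.\<close>
  proof (rule brown_thompson_iso[where d = real])
    show "real l < step_map p j (real l)" if "j < l" for j l
      using that p by (intro step_map_less) auto
  qed (simp_all add: step_map_shift step_map_le)
  then have "abelianization (brown_thompson p) \<cong> abelianization G"
    by (intro abelianization_cong group_presented_group) (simp_all add: G_def)
  then have "abelianization G \<cong> abelianization (brown_thompson p)"
    by (rule A.iso_sym)
  then have "abelianization G \<cong> free_abelian k"
    using abelianization_brown_thompson[OF p(1)] iso_trans unfolding p(2) by blast
  moreover have "chain_group n G"
    unfolding G_def using assms p by (intro chain_group_brown_thompson) auto
  ultimately show ?thesis by blast
qed

end
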